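(* Let $D$ be an $n$-diagram with $n\ge1$. Consider the following algorithm. Step 1. Fix any chord of $D$, label it $1$, and choose one endpoint of chord $1$, marking it $\ast$. Step 2. For each labeling of the remaining chords by $2,\dots,n$: (i) form the name $N$ of $D$ obtained by reading the labels around the circle starting at $\ast$ (so that the first entry of $N$ is the label $1$ of the endpoint $\ast$); (ii) construct the canonical braiding of $D$ relative to $N$; (iii) perform all possible decreasing stabilizations, starting from the canonical braiding and continuing until none is possible, and record the number of strands of the resulting word. Then the minimum of the numbers recorded in this algorithm is the braid index of $D$.
   Context: An $n$-diagram (chord diagram) is an oriented circle with $2n$ distinct marked points partitioned into $n$ pairs (the chords), up to orientation-preserving homeomorphism. A name of $D$ is the string of $2n$ integers obtained by labeling the chords bijectively by $1,\dots,n$, choosing a starting point on the circle, and recording the chord labels of the endpoints met while traversing the circle once in the direction of its orientation. A word on $m$ strands is a word $W=A(i_1,j_1)\cdots A(i_n,j_n)$ in symbols $A(i,j)=A(j,i)$, $i\neq j$, $1\le i,j\le m$, where $A(i,j)$ is viewed as a horizontal chord joining strands $i$ and $j$ of the identity $m$-braid, the letters being placed from top to bottom. Its closure is the $n$-diagram obtained by joining the bottom of strand $k$ to the top of strand $k+1$ ($k<m$) and the bottom of strand $m$ to the top of strand $1$; i.e. the cyclic sequence of chord labels around the circle is $L_1L_2\cdots L_m$, where $L_k$ is the increasing sequence of those $r$ with $k\in\{i_r,j_r\}$. If $D$ is the closure of $W$, then $W$ is called a braiding of $D$. The braid index of $D$ is the least $m$ such that $D$ has a braiding on $m$ strands. Canonical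 braiding relative to a name $N$: for $1\le r\le n$ let $i_r<j_r$ be the positions of the two occurrences of $r$ in $N$; the canonical braiding is the word $A(i_1,j_1)A(i_2,j_2)\cdots A(i_n,j_n)$ on $2n$ strands. Decreasing stabilization: it can be applied to a word $U A(i,j) V$ on $m$ strands, with $2\le j\le m$ and $i\ne j-1$ (either $i<j$ or $i>j$ is allowed), when the index $j$ does not occur in $U$ and the index $j-1$ does not occur in $V$. It replaces the word by the word on $m-1$ strands obtained by lowering by one every index that is greater than or equal to $j$ (so strands $j-1$ and $j$ are merged, and the letter $A(i,j)$ becomes a letter with an endpoint on strand $j-1$). *)

theory Defs
  imports Main "HOL-Library.Disjoint_Sets" "HOL-Library.FuncSet"
begin

text \<open>
  The marked points of a diagram are numbered \<open>0, \<dots>, 2n - 1\<close> in the order in which they are met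
  when traversing the oriented circle from some marked point. An orientation-preserving
  homeomorphism acts on the marked points by a bijection that preserves their cyclic order, and
  every such bijection is induced by a homeomorphism. On numbered points these bijections are the
  rotations modulo \<open>2n\<close>.
\<close>

definition chord_systems :: "nat \<Rightarrow> nat set set set" where
  "chord_systems n = {P. partition_on {0..<2 * n} P \<and> (\<forall>c\<in>P. card c = 2)}"

definition rotate_chords :: "nat \<Rightarrow> nat \<Rightarrow> nat set set \<Rightarrow> nat set set" where
  "rotate_chords n k P = (\<lambda>c. (\<lambda>p. (p + k) mod (2 * n)) ` c) ` P"

definition same_diagram :: "nat \<Rightarrow> (nat set set \<times> nat set set) set" where
  "same_diagram n =
     {(P, Q). P \<in> chord_systems n \<and> Q \<in> chord_systems n \<and> (\<exists>k. Q = rotate_chords n k P)}"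

definition chord_diagrams :: "nat \<Rightarrow> nat set set set set" where
  "chord_diagrams n = chord_systems n // same_diagram n"

definition labelings :: "nat \<Rightarrow> nat set set \<Rightarrow> (nat set \<Rightarrow> nat) set" where
  "labelings n P = {l \<in> extensional P. bij_betw l P {1..n}}"

definition chord_at :: "nat set set \<Rightarrow> nat \<Rightarrow> nat set" where
  "chord_at P p = (THE c. c \<in> P \<and> p \<in> c)"

definition name_from :: "nat \<Rightarrow> nat set set \<Rightarrow> (nat set \<Rightarrow> nat) \<Rightarrow> nat \<Rightarrow> nat list" where
  "name_from n P l s = map (\<lambda>t. l (chord_at P ((s + t) mod (2 * n)))) [0..<2 * n]"

definition diagram_of_name :: "nat list \<Rightarrow> nat set set set" where
  "diagram_of_name N =
     same_diagram (length N div 2) `` {(\<lambda>r. {p. p < length N \<and> N ! p = r}) ` set N}"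

text \<open>A letter is an unordered pair of strands, so that \<open>letter i j = letter j i\<close>; strands are numbered from 1.\<close>

abbreviation letter :: "nat \<Rightarrow> nat \<Rightarrow> nat set" where
  "letter i j \<equiv> {i, j}"

definition word_on :: "nat \<Rightarrow> nat set list \<Rightarrow> bool" where
  "word_on m W \<longleftrightarrow> (\<forall>a\<in>set W. \<exists>i j. i \<noteq> j \<and> i \<in> {1..m} \<and> j \<in> {1..m} \<and> a = letter i j)"

text \<open>The \<open>r\<close>-th letter of \<open>W\<close> is \<open>W ! (r - 1)\<close>, since list positions start at 0.\<close>

definition strand_labels :: "nat set list \<Rightarrow> nat \<Rightarrow> nat list" where
  "strand_labels W k = filter (\<lambda>r. k \<in> W ! (r - 1)) [1..<length W + 1]"

definition braid_closure :: "nat \<Rightarrow> nat set list \<Rightarrow> nat set set set" where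
  "braid_closure m W = diagram_of_name (concat (map (strand_labels W) [1..<m + 1]))"

definition is_braiding :: "nat \<Rightarrow> nat set list \<Rightarrow> nat set set set \<Rightarrow> bool" where
  "is_braiding m W D \<longleftrightarrow> word_on m W \<and> braid_closure m W = D"

definition braid_index :: "nat set set set \<Rightarrow> nat" where
  "braid_index D = (LEAST m. \<exists>W. is_braiding m W D)"

text \<open>
  In a name each label \<open>r\<close> occurs exactly twice, so its set of positions (counted from 1) is the
  letter \<open>letter i\<^sub>r j\<^sub>r\<close>. The word is on \<open>length N\<close> strands.
\<close>

definition canonical_braiding :: "nat list \<Rightarrow> nat set list" where
  "canonical_braiding N =
     map (\<lambda>r. {p + 1 |p. p < length N \<and> N ! p = r}) [1..<length N div 2 + 1]"

definition lower_indices :: "nat \<Rightarrow> nat set \<Rightarrow> nat set" where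
  "lower_indices j a = (\<lambda>k. if j \<le> k then k - 1 else k) ` a"

text \<open>The number of strands is not determined by the letters, so words are paired with it.\<close>

inductive dec_stab :: "nat \<times> nat set list \<Rightarrow> nat \<times> nat set list \<Rightarrow> bool" where
  "dec_stab (m, U @ [letter i j] @ V) (m - 1, map (lower_indices j) (U @ [letter i j] @ V))"
  if "word_on m (U @ [letter i j] @ V)"
    and "2 \<le> j" and "j \<le> m" and "i \<noteq> j - 1"
    and "\<forall>a\<in>set U. j \<notin> a" and "\<forall>a\<in>set V. j - 1 \<notin> a"

definition stabilizes_fully :: "nat \<times> nat set list \<Rightarrow> nat \<times> nat set list \<Rightarrow> bool" where
  "stabilizes_fully X Y \<longleftrightarrow> dec_stab\<^sup>*\<^sup>* X Y \<and> (\<nexists>Z. dec_stab Y Z)"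

text \<open>
  \<open>R\<close> is the set of numbers recorded by some run of the algorithm on the chord \<open>c\<close> with marked
  endpoint \<open>s\<close>. A run follows, for every labeling, one maximal sequence of decreasing
  stabilizations, in an arbitrary order, ending at \<open>F l\<close>.
\<close>

definition recorded_by_run :: "nat \<Rightarrow> nat set set \<Rightarrow> nat set \<Rightarrow> nat \<Rightarrow> nat set \<Rightarrow> bool" where
  "recorded_by_run n P c s R \<longleftrightarrow>
     (\<exists>F. (\<forall>l\<in>{l \<in> labelings n P. l c = 1}.
              stabilizes_fully (2 * n, canonical_braiding (name_from n P l s)) (F l)) \<and>
          R = (\<lambda>l. fst (F l)) ` {l \<in> labelings n P. l c = 1})"

end

theory Submission
  imports Defs
begin

text \<open>
  A decreasing stabilization concatenates two adjacent strands of a word whose label sequences stay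
  increasing when joined, and it does not change the name read off the closure. A maximal sequence
  of stabilizations therefore ends with the increasing runs of the name \<open>N\<close> as strands, in whatever
  order it is performed. Since \<open>N\<close> starts with 1, the number of runs is the number of cyclic (weak)
  descents of \<open>N\<close>. Conversely, the closure of a word on \<open>m\<close> strands has a name with at most \<open>m\<close>
  cyclic descents, and this number is invariant both under rotating the name and under shifting all
  labels cyclically modulo \<open>n\<close>, so the chosen chord can be given the label 1.
\<close>

section \<open>Descents\<close>

text \<open>Weak descents are counted because the two endpoints of a chord may be neighbours on the
  circle, and a strand, whose labels strictly increase, cannot hold both.\<close>

fun descents :: "nat list \<Rightarrow> nat" where
  "descents [] = 0"
| "descents [x] = 0"
| "descents (x # y # zs) = of_bool (y \<le> x) + descents (y # zs)"

text \<open>A function of the position replaces the list, so that rotating and relabelling are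
  compositions. The summand at \<open>L - 1\<close> compares the last point with the first.\<close>

definition cyclic_descents :: "nat \<Rightarrow> (nat \<Rightarrow> nat) \<Rightarrow> nat" where
  "cyclic_descents L f = (\<Sum>p<L. of_bool (f (Suc p mod L) \<le> f p))"

lemma descents_append:
  "descents (xs @ ys) =
     descents xs + descents ys + of_bool (xs \<noteq> [] \<and> ys \<noteq> [] \<and> hd ys \<le> last xs)"
proof (induction xs rule: descents.induct)
  case (2 x)
  then show ?case by (cases ys) auto
qed auto

lemma descents_strictly_increasing:
  "sorted_wrt (<) xs \<Longrightarrow> descents xs = 0"
  by (induction xs rule: descents.induct) auto

text \<open>Strictly increasing blocks have no descent inside, so only junctions can contribute.
  Empty blocks are allowed, since strands of an arbitrary word may be empty.\<close>

lemma descents_concat_le: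
  assumes "bs \<noteq> []" "\<forall>b\<in>set bs. sorted_wrt (<) b"
  shows "Suc (descents (concat bs)) \<le> length bs"
  using assms
proof (induction bs rule: list_nonempty_induct)
  case (single b)
  then show ?case by (simp add: descents_strictly_increasing)
next
  case (cons b bs)
  then show ?case by (simp add: descents_append descents_strictly_increasing)
qed

text \<open>Now every junction is a descent: the blocks are the maximal increasing runs.\<close>

lemma descents_concat_eq:
  assumes "bs \<noteq> []" "\<forall>b\<in>set bs. sorted_wrt (<) b \<and> b \<noteq> []"
    and "successively (\<lambda>a b. hd b \<le> last a) bs"
  shows "Suc (descents (concat bs)) = length bs"
  using assms
proof (induction bs rule: list_nonempty_induct)
  case (single b)
  then show ?case by (simp add: descents_strictly_increasing)
next
  case (cons b bs)
  then obtain b' bs' where "bs = b' # bs'" by (cases bs) auto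
  with cons show ?case by (simp add: descents_append descents_strictly_increasing)
qed

lemma descents_conv_sum:
  "descents xs = (\<Sum>p<length xs - 1. of_bool (xs ! Suc p \<le> xs ! p))"
  by (induction xs rule: descents.induct)
    (simp_all add: sum.lessThan_Suc_shift del: sum.lessThan_Suc sum_of_bool_eq)

lemma cyclic_descents_nth:
  assumes "xs \<noteq> []"
  shows "cyclic_descents (length xs) ((!) xs) = descents xs + of_bool (hd xs \<le> last xs)"
proof -
  from assms obtain k where k: "length xs = Suc k" by (cases xs) auto
  then show ?thesis
    using assms by (simp add: cyclic_descents_def descents_conv_sum hd_conv_nth last_conv_nth)
qed

section \<open>Rotations of the circle\<close>

lemma bij_betw_rotation:
  assumes "0 < L"
  shows "bij_betw (\<lambda>p. (p + k) mod L) {..<L} {..<(L::nat)}"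
proof -
  have "q \<in> (\<lambda>p. (p + k) mod L) ` {..<L}" if "q < L" for q
  proof
    \<comment> \<open>\<open>L * k - k\<close> represents \<open>-k\<close> modulo \<open>L\<close>;
      it is not truncated because \<open>1 \<le> L\<close>.\<close>
    have "q + (L * k - k) + k = q + L * k" using mult_le_mono1[of 1 L k] assms by linarith
    then show "q = ((q + (L * k - k)) mod L + k) mod L"
      using that by (simp only: mod_add_left_eq mod_mult_self2 mod_less)
  qed (use assms in simp)
  then have surj: "(\<lambda>p. (p + k) mod L) ` {..<L} = {..<L}" using assms by auto
  then have "inj_on (\<lambda>p. (p + k) mod L) {..<L}" by (intro eq_card_imp_inj_on) simp_all
  with surj show ?thesis by (simp add: bij_betw_def)
qed

lemma sum_rotation:
  assumes "0 < (L::nat)"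
  shows "(\<Sum>p<L. g ((p + k) mod L)) = (\<Sum>p<L. g p)"
  using sum.reindex_bij_betw[OF bij_betw_rotation[OF assms, of k], of g] .

text \<open>Rotation commutes with the successor modulo \<open>L\<close>, so it only permutes the
  pairs of neighbours.\<close>

lemma cyclic_descents_rotation:
  assumes "0 < L"
  shows "cyclic_descents L (\<lambda>p. f ((p + k) mod L)) = cyclic_descents L f"
proof -
  have "(Suc p mod L + k) mod L = Suc ((p + k) mod L) mod L" for p
    by (simp add: mod_Suc_eq mod_add_left_eq)
  then show ?thesis
    unfolding cyclic_descents_def
    using sum_rotation[OF assms, of "\<lambda>p. of_bool (f (Suc p mod L) \<le> f p)" k]
    by (simp del: sum_of_bool_eq)
qed

text \<open>
  The forward distance in \<open>{1..n}\<close> from \<open>f p\<close> to its successor around the circle differs from their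
  difference by \<open>n\<close> exactly at the descents. The differences telescope, so the number of descents
  depends only on the differences modulo \<open>n\<close>.
\<close>

lemma cyclic_descents_conv_mod:
  assumes "0 < L" and f: "\<And>p. p < L \<Longrightarrow> f p \<in> {1..n}"
  shows "int n * int (cyclic_descents L f) =
    (\<Sum>p<L. (int (f (Suc p mod L)) - int (f p) - 1) mod int n + 1)"
proof -
  \<comment> \<open>Subtracting 1 before \<open>mod\<close> and adding it afterwards gives equal
    labels the distance \<open>n\<close> instead of 0, so that weak descents are counted.\<close>
  have step: "int n * of_bool (b \<le> a) = (int b - int a - 1) mod int n + 1 + (int a - int b)"
    if "a \<in> {1..n}" "b \<in> {1..n}" for a b
  proof (cases "b \<le> a")
    case True
    then have "(int b - int a - 1) mod int n = (int b - int a - 1 + int n) mod int n" by simp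
    also have "\<dots> = int b - int a - 1 + int n"
      using that True by (intro mod_pos_pos_trivial) auto
    finally show ?thesis using True by simp
  next
    case False
    then have "(int b - int a - 1) mod int n = int b - int a - 1"
      using that by (intro mod_pos_pos_trivial) auto
    then show ?thesis using False by simp
  qed
  have "int n * int (cyclic_descents L f) =
      (\<Sum>p<L. int n * of_bool (f (Suc p mod L) \<le> f p))"
    by (simp add: cyclic_descents_def sum_distrib_left)
  also have "\<dots> = (\<Sum>p<L. (int (f (Suc p mod L)) - int (f p) - 1) mod int n + 1
      + (int (f p) - int (f (Suc p mod L))))"
    using assms by (intro sum.cong refl step f) auto
  also have "\<dots> = (\<Sum>p<L. (int (f (Suc p mod L)) - int (f p) - 1) mod int n + 1)
      + ((\<Sum>p<L. int (f p)) - (\<Sum>p<L. int (f (Suc p mod L))))"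
    by (simp only: sum.distrib sum_subtractf)
  \<comment> \<open>The successor is the rotation by 1, so the two sums of labels cancel.\<close>
  also have "(\<Sum>p<L. int (f (Suc p mod L))) = (\<Sum>p<L. int (f p))"
    using sum_rotation[OF assms(1), of "\<lambda>p. int (f p)" 1] by simp
  finally show ?thesis by simp
qed

text \<open>The cyclic shift that brings \<open>r\<close> to 1. It is computed in \<open>int\<close>
  to avoid truncated subtraction; the final \<open>+ 1\<close> turns residues into labels.\<close>

definition shift_label :: "nat \<Rightarrow> nat \<Rightarrow> nat \<Rightarrow> nat" where
  "shift_label n r x = nat ((int x - int r) mod int n) + 1"

lemma shift_label_range:
  assumes "0 < n"
  shows "shift_label n r x \<in> {1..n}"
proof -
  have "0 \<le> (int x - int r) mod int n" "(int x - int r) mod int n < int n" using assms by simp_all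
  then show ?thesis by (simp add: shift_label_def nat_less_iff Suc_le_eq)
qed

lemma shift_label_self [simp]: "shift_label n r r = 1"
  by (simp add: shift_label_def)

lemma int_shift_label: "0 < n \<Longrightarrow> int (shift_label n r x) = (int x - int r) mod int n + 1"
  by (simp add: shift_label_def)

text \<open>Labels in \<open>{1..n}\<close> differ by less than \<open>n\<close>, so congruent ones
  are equal.\<close>

lemma inj_on_shift_label: "inj_on (shift_label n r) {1..n}"
proof (rule inj_onI)
  fix x y assume xy: "x \<in> {1..n}" "y \<in> {1..n}" "shift_label n r x = shift_label n r y"
  then have n: "0 < n" by auto
  from xy(3) have "(int x - int r) mod int n = (int y - int r) mod int n"
    using int_shift_label[OF n, of r x] int_shift_label[OF n, of r y] by simp
  then have "int n dvd int x - int y"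
    by (simp add: mod_eq_dvd_iff)
  moreover have "\<bar>int x - int y\<bar> < int n" using xy(1,2) by auto
  ultimately show "x = y" using dvd_imp_le_int[of "int x - int y" "int n"] by (cases "x = y") simp_all
qed

text \<open>A shift preserves differences modulo \<open>n\<close>, and by
  \<open>cyclic_descents_conv_mod\<close> these determine the count.\<close>

lemma cyclic_descents_shift_label:
  assumes "0 < L" "0 < n" and f: "\<And>p. p < L \<Longrightarrow> f p \<in> {1..n}"
  shows "cyclic_descents L (\<lambda>p. shift_label n r (f p)) = cyclic_descents L f"
proof -
  have "(int (shift_label n r b) - int (shift_label n r a) - 1) mod int n
      = (int b - int a - 1) mod int n" for a b
  proof -
    have "(int (shift_label n r b) - int (shift_label n r a) - 1) mod int n
        = (((int b - int r) mod int n - (int a - int r) mod int n) - 1) mod int n"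
      using assms(2) by (simp add: int_shift_label)
    also have "\<dots> = (((int b - int r) - (int a - int r)) - 1) mod int n"
      using mod_diff_cong[OF mod_diff_eq refl] .
    finally show ?thesis by simp
  qed
  then have "int n * int (cyclic_descents L (\<lambda>p. shift_label n r (f p)))
      = int n * int (cyclic_descents L f)"
    using cyclic_descents_conv_mod[of L "\<lambda>p. shift_label n r (f p)" n]
      cyclic_descents_conv_mod[of L f n] assms shift_label_range by simp
  then show ?thesis using assms(2) by simp
qed

section \<open>Decreasing stabilizations\<close>

lemma strictly_increasing_strand_labels: "sorted_wrt (<) (strand_labels W k)"
  unfolding strand_labels_def by (intro sorted_wrt_filter) (simp del: upt_Suc)

lemma set_strand_labels:
  "set (strand_labels W k) = {r \<in> {1..length W}. k \<in> W ! (r - 1)}"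
  by (auto simp: strand_labels_def)

text \<open>Reduces identities between strands to identities between sets of labels.\<close>

lemma strictly_increasing_unique:
  assumes "sorted_wrt (<) xs" "sorted_wrt (<) ys" "set xs = set (ys :: nat list)"
  shows "xs = ys"
  using assms strict_sorted_equal by blast

lemma word_on_letter:
  assumes "word_on m W" "r \<in> {1..length W}"
  obtains i j where "i \<noteq> j" "i \<in> {1..m}" "j \<in> {1..m}" "W ! (r - 1) = {i, j}"
proof -
  have "W ! (r - 1) \<in> set W" using assms(2) by (auto intro!: nth_mem)
  with assms(1) that show thesis unfolding word_on_def by blast
qed

section \<open>Strands as lists of labels\<close>

definition strands :: "nat \<times> nat set list \<Rightarrow> nat list list" where
  "strands X = map (strand_labels (snd X)) [1..<fst X + 1]"

lemma length_strands [simp]: "length (strands X) = fst X"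
  by (simp add: strands_def)

lemma strands_nth: "k < fst X \<Longrightarrow> strands X ! k = strand_labels (snd X) (Suc k)"
  by (simp add: strands_def del: upt_Suc)

lemma strictly_increasing_strands: "b \<in> set (strands X) \<Longrightarrow> sorted_wrt (<) b"
  by (auto simp: strands_def strictly_increasing_strand_labels)

text \<open>The invariant of a sequence of stabilizations. Empty strands are excluded because they
  would be counted without contributing a run of \<open>N\<close>.\<close>

definition braids_name :: "nat list \<Rightarrow> nat \<times> nat set list \<Rightarrow> bool" where
  "braids_name N X \<longleftrightarrow> word_on (fst X) (snd X) \<and> concat (strands X) = N \<and> [] \<notin> set (strands X)"

lemma braid_closure_strands: "braid_closure m W = diagram_of_name (concat (strands (m, W)))"
  by (simp add: braid_closure_def strands_def)

lemma strand_labels_map_cong: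
  assumes "\<And>a. k \<in> h a \<longleftrightarrow> k' \<in> a"
  shows "strand_labels (map h W) k = strand_labels W k'"
proof (rule strictly_increasing_unique)
  show "set (strand_labels (map h W) k) = set (strand_labels W k')"
    by (auto simp: set_strand_labels assms)
qed (rule strictly_increasing_strand_labels)+

lemma strand_labels_lower:
  assumes "k < j - 1"
  shows "strand_labels (map (lower_indices j) W) k = strand_labels W k"
proof (rule strand_labels_map_cong)
  have "k = (if j \<le> x then x - 1 else x) \<longleftrightarrow> x = k" for x
    using assms by auto
  then show "k \<in> lower_indices j a \<longleftrightarrow> k \<in> a" for a
    unfolding lower_indices_def image_iff by simp
qed

lemma strand_labels_lower':
  assumes "1 \<le> j" "j \<le> k"
  shows "strand_labels (map (lower_indices j) W) k = strand_labels W (Suc k)"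
proof (rule strand_labels_map_cong)
  have "k = (if j \<le> x then x - 1 else x) \<longleftrightarrow> x = Suc k" for x
    using assms by auto
  then show "k \<in> lower_indices j a \<longleftrightarrow> Suc k \<in> a" for a
    unfolding lower_indices_def image_iff by simp
qed

text \<open>Lowering identifies exactly the indices \<open>j - 1\<close> and \<open>j\<close>, so
  the label sets are united; the hypothesis makes the concatenation increasing.\<close>

lemma strand_labels_merge:
  assumes "1 \<le> j"
    and "\<And>r r'. r \<in> set (strand_labels W (j - 1)) \<Longrightarrow> r' \<in> set (strand_labels W j) \<Longrightarrow> r < r'"
  shows "strand_labels (map (lower_indices j) W) (j - 1)
    = strand_labels W (j - 1) @ strand_labels W j"
proof (rule strictly_increasing_unique)
  show "sorted_wrt (<) (strand_labels W (j - 1) @ strand_labels W j)"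
    unfolding sorted_wrt_append using assms(2) strictly_increasing_strand_labels by blast
  have "j - 1 = (if j \<le> x then x - 1 else x) \<longleftrightarrow> x = j - 1 \<or> x = j" for x
    using assms(1) by auto
  then have "j - 1 \<in> lower_indices j a \<longleftrightarrow> j - 1 \<in> a \<or> j \<in> a" for a
    unfolding lower_indices_def image_iff by auto
  note merged = this
  have "j - 1 \<in> map (lower_indices j) W ! (r - 1) \<longleftrightarrow> j - 1 \<in> W ! (r - 1) \<or> j \<in> W ! (r - 1)"
    if "r \<in> {1..length W}" for r
    using merged[of "W ! (r - 1)"] that by (subst nth_map) auto
  then show "set (strand_labels (map (lower_indices j) W) (j - 1))
      = set (strand_labels W (j - 1) @ strand_labels W j)"
    unfolding set_strand_labels set_append length_map by blast
qed (rule strictly_increasing_strand_labels)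

text \<open>The common context \<open>A\<close>, \<open>B\<close> makes it visible that the
  concatenation of all strands, hence the name, is unchanged.\<close>

lemma strands_merge:
  assumes "2 \<le> j" "j \<le> m"
    and "\<And>r r'. r \<in> set (strand_labels W (j - 1)) \<Longrightarrow> r' \<in> set (strand_labels W j) \<Longrightarrow> r < r'"
  obtains A B where
    "strands (m, W) = A @ [strand_labels W (j - 1), strand_labels W j] @ B"
    "strands (m - 1, map (lower_indices j) W) = A @ [strand_labels W (j - 1) @ strand_labels W j] @ B"
proof
  let ?A = "map (strand_labels W) [1..<j - 1]" and ?B = "map (strand_labels W) [Suc j..<m + 1]"
  have 1: "[1..<m + 1] = [1..<j - 1] @ [j - 1, j] @ [Suc j..<m + 1]"
  proof -
    have "[1..<m + 1] = [1..<j - 1] @ [j - 1..<m + 1]"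
      using assms(1,2) upt_add_eq_append[of 1 "j - 1" "m + 1 - (j - 1)"] by simp
    then show ?thesis using assms(1,2) by (simp add: upt_conv_Cons)
  qed
  then show "strands (m, W) = ?A @ [strand_labels W (j - 1), strand_labels W j] @ ?B"
    by (simp add: strands_def)
  have 2: "[1..<m - 1 + 1] = [1..<j - 1] @ [j - 1] @ [j..<m]"
  proof -
    have "[1..<m] = [1..<j - 1] @ [j - 1..<m]"
      using assms(1,2) upt_add_eq_append[of 1 "j - 1" "m - (j - 1)"] by simp
    then show ?thesis using assms(1,2) by (simp add: upt_conv_Cons)
  qed
  have 3: "map (strand_labels (map (lower_indices j) W)) [1..<j - 1] = ?A"
    by (auto intro: strand_labels_lower)
  have "map (strand_labels (map (lower_indices j) W)) [j..<m]
      = map (strand_labels W) (map Suc [j..<m])"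
    using assms(1) by (auto simp: strand_labels_lower')
  also have "\<dots> = ?B" by (simp add: map_Suc_upt)
  finally have 4: "map (strand_labels (map (lower_indices j) W)) [j..<m] = ?B" .
  have 5: "strand_labels (map (lower_indices j) W) (j - 1)
      = strand_labels W (j - 1) @ strand_labels W j"
    using assms by (intro strand_labels_merge) auto
  show "strands (m - 1, map (lower_indices j) W)
      = ?A @ [strand_labels W (j - 1) @ strand_labels W j] @ ?B"
    unfolding strands_def fst_conv snd_conv 2 map_append 3 4 by (simp only: list.map 5)
qed

text \<open>Only \<open>{j - 1, j}\<close> could collapse to a single index.\<close>

lemma word_on_lower:
  assumes "word_on m W" "2 \<le> j" "j \<le> m" "{j - 1, j} \<notin> set W"
  shows "word_on (m - 1) (map (lower_indices j) W)"
  unfolding word_on_def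
proof
  fix b assume "b \<in> set (map (lower_indices j) W)"
  then obtain a where a: "a \<in> set W" "b = lower_indices j a" by auto
  with assms(1) obtain i k where ik: "i \<noteq> k" "i \<in> {1..m}" "k \<in> {1..m}" "a = {i, k}"
    unfolding word_on_def by blast
  let ?h = "\<lambda>k. if j \<le> k then k - 1 else k"
  have "\<not> (i = j - 1 \<and> k = j)" "\<not> (i = j \<and> k = j - 1)"
    using a ik assms(4) by (auto simp: insert_commute)
  then have "?h i \<noteq> ?h k" using ik(1) assms(2) by auto
  moreover have "?h i \<in> {1..m - 1}" "?h k \<in> {1..m - 1}" using ik assms(2,3) by auto
  moreover have "b = {?h i, ?h k}" using a ik by (simp add: lower_indices_def)
  ultimately show "\<exists>i j. i \<noteq> j \<and> i \<in> {1..m - 1} \<and> j \<in> {1..m - 1} \<and> b = {i, j}" by blast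
qed

text \<open>The letter \<open>{i, j}\<close> separates the two merged strands: the labels of strand
  \<open>j - 1\<close> come before it, those of strand \<open>j\<close> at it or after it.\<close>

lemma dec_stab_braids_name:
  assumes "dec_stab X Y" "braids_name N X"
  shows "braids_name N Y \<and> fst Y < fst X"
  using assms
proof cases
  case (1 m U i j V)
  define W where "W = U @ [{i, j}] @ V"
  have len: "length W = Suc (length U + length V)" by (simp add: W_def)
  have at_U: "W ! (r - 1) \<in> set U" if "1 \<le> r" "r \<le> length U" for r
    using that by (auto simp: W_def nth_append)
  have at_V: "W ! (r - 1) \<in> set V" if "length U + 1 < r" "r \<le> length W" for r
    using that by (auto simp: W_def nth_append nth_Cons' len)
  have at_mid: "W ! length U = {i, j}" by (simp add: W_def)
  have "i \<noteq> j" using 1(3) by (auto simp: word_on_def doubleton_eq_iff)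
  \<comment> \<open>\<open>length U + 1\<close> is the label of the middle letter, as labels start
    at 1.\<close>
  have lo: "r < length U + 1" if "r \<in> set (strand_labels W (j - 1))" for r
  proof (rule ccontr)
    assume "\<not> ?thesis"
    then consider "r = length U + 1" | "length U + 1 < r" by linarith
    then show False
    proof cases
      case 1
      with that at_mid \<open>i \<noteq> j - 1\<close> \<open>2 \<le> j\<close> show False by (auto simp: set_strand_labels)
    next
      case 2
      with that at_V[of r] \<open>\<forall>a\<in>set V. j - 1 \<notin> a\<close> show False by (auto simp: set_strand_labels)
    qed
  qed
  have hi: "length U + 1 \<le> r" if "r \<in> set (strand_labels W j)" for r
    using that at_U[of r] \<open>\<forall>a\<in>set U. j \<notin> a\<close> by (fastforce simp: set_strand_labels)
  obtain A B where AB: "strands (m, W) = A @ [strand_labels W (j - 1), strand_labels W j] @ B"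
    "strands (m - 1, map (lower_indices j) W) = A @ [strand_labels W (j - 1) @ strand_labels W j] @ B"
  proof (rule strands_merge[OF \<open>2 \<le> j\<close> \<open>j \<le> m\<close>])
    show "r < r'" if "r \<in> set (strand_labels W (j - 1))" "r' \<in> set (strand_labels W j)" for r r'
      using lo[OF that(1)] hi[OF that(2)] by simp
  qed
  \<comment> \<open>This letter contains \<open>j\<close>, so it is not in \<open>U\<close>; it
    contains \<open>j - 1\<close>, so it is not in \<open>V\<close>; and
    \<open>i \<noteq> j - 1\<close> excludes the middle.\<close>
  have "{j - 1, j} \<notin> set W"
    using 1 \<open>i \<noteq> j\<close> by (auto simp: W_def doubleton_eq_iff)
  then have "word_on (m - 1) (map (lower_indices j) W)"
    using word_on_lower 1 W_def by blast
  moreover have "X = (m, W)" "Y = (m - 1, map (lower_indices j) W)"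
    using 1 by (simp_all add: W_def)
  ultimately show ?thesis
    using assms(2) AB \<open>2 \<le> j\<close> \<open>j \<le> m\<close> by (auto simp: braids_name_def)
qed

text \<open>The word is cut at the first letter that meets strand \<open>j\<close>; everything on
  strand \<open>j - 1\<close> lies above this letter.\<close>

lemma dec_stab_exists:
  assumes "word_on m W" "2 \<le> j" "j \<le> m" "strand_labels W (j - 1) \<noteq> []" "strand_labels W j \<noteq> []"
    and less: "last (strand_labels W (j - 1)) < hd (strand_labels W j)"
  shows "\<exists>Z. dec_stab (m, W) Z"
proof -
  define r where "r = hd (strand_labels W j)"
  have r: "r \<in> {1..length W}" "j \<in> W ! (r - 1)"
    using hd_in_set[OF assms(5)] by (auto simp: set_strand_labels r_def)
  have lo: "q < r" if "q \<in> set (strand_labels W (j - 1))" for q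
  proof -
    have "q \<le> last (strand_labels W (j - 1))"
      using that strictly_increasing_strand_labels[of W "j - 1"]
      by (cases "strand_labels W (j - 1)" rule: rev_cases) (auto simp: sorted_wrt_append)
    then show ?thesis using less by (simp add: r_def)
  qed
  have hi: "r \<le> q" if "q \<in> set (strand_labels W j)" for q
    using that strictly_increasing_strand_labels[of W j] assms(5)
    by (cases "strand_labels W j") (auto simp: r_def)
  obtain i where i: "i \<noteq> j" "W ! (r - 1) = {i, j}"
  proof -
    obtain i k where "i \<noteq> k" "W ! (r - 1) = {i, k}" using word_on_letter[OF assms(1) r(1)] .
    moreover from this r(2) have "j = i \<or> j = k" by blast
    ultimately show thesis using that[of i] that[of k] by (auto simp: insert_commute)
  qed
  let ?U = "take (r - 1) W" and ?V = "drop r W"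
  have W: "W = ?U @ [{i, j}] @ ?V"
    using id_take_nth_drop[of "r - 1" W] r(1) i(2) by (simp add: Suc_le_lessD)
  \<comment> \<open>Otherwise \<open>r\<close> would itself be a label of strand
    \<open>j - 1\<close>, and \<open>lo\<close> would give \<open>r < r\<close>.\<close>
  have "i \<noteq> j - 1"
    using lo[of r] r(1) i by (auto simp: set_strand_labels)
  moreover have "\<forall>a\<in>set ?U. j \<notin> a"
  proof (intro ballI notI)
    fix a assume "a \<in> set ?U" "j \<in> a"
    then obtain q where "q < r - 1" "q < length W" "a = W ! q" by (auto simp: in_set_conv_nth)
    with \<open>j \<in> a\<close> hi[of "Suc q"] show False by (auto simp: set_strand_labels)
  qed
  moreover have "\<forall>a\<in>set ?V. j - 1 \<notin> a"
  proof (intro ballI notI)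
    fix a assume "a \<in> set ?V" "j - 1 \<in> a"
    then obtain q where "q < length W - r" "a = W ! (r + q)" by (auto simp: in_set_conv_nth)
    moreover from this have "Suc (r + q) \<le> length W" by linarith
    ultimately show False using \<open>j - 1 \<in> a\<close> lo[of "Suc (r + q)"] by (simp add: set_strand_labels)
  qed
  ultimately show ?thesis
    using dec_stab.intros[of m ?U i j ?V, folded W] assms(1-3) by blast
qed

text \<open>By \<open>dec_stab_exists\<close> a junction that is not a descent would allow a further
  step. So the strands are the increasing runs of \<open>N\<close>, whatever the order of the
  steps.\<close>

lemma fully_stabilized_strands:
  assumes "braids_name N X" "N \<noteq> []" "\<nexists>Z. dec_stab X Z"
  shows "fst X = Suc (descents N)"
proof -
  obtain m W where X: "X = (m, W)" by (cases X)
  have ne: "strands X \<noteq> []" using assms(1,2) by (auto simp: braids_name_def)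
  have nonempty: "strand_labels W (Suc k) \<noteq> []" if "k < m" for k
    using assms(1) that strands_nth[of k X] nth_mem[of k "strands X"] by (auto simp: X braids_name_def)
  have "successively (\<lambda>a b. hd b \<le> last a) (strands X)"
    unfolding successively_conv_nth
  proof (intro allI impI)
    fix k assume k: "Suc k < length (strands X)"
    show "hd (strands X ! Suc k) \<le> last (strands X ! k)"
    proof (rule ccontr)
      assume "\<not> ?thesis"
      \<comment> \<open>Positions in \<open>strands X\<close> start at 0 and strands at 1, so
        position \<open>Suc k\<close> is strand \<open>Suc (Suc k)\<close>.\<close>
      then have "\<exists>Z. dec_stab (m, W) Z"
        using k assms(1) nonempty[of k] nonempty[of "Suc k"]
        by (intro dec_stab_exists[of _ _ "Suc (Suc k)"]) (auto simp: strands_nth X braids_name_def)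
      with assms(3) X show False by simp
    qed
  qed
  moreover have "\<forall>b\<in>set (strands X). sorted_wrt (<) b \<and> b \<noteq> []"
    using assms(1) strictly_increasing_strands by (auto simp: braids_name_def)
  ultimately show ?thesis
    using descents_concat_eq[OF ne] assms(1) by (simp add: braids_name_def)
qed

lemma dec_stab_rtranclp_braids_name:
  assumes "dec_stab\<^sup>*\<^sup>* X Y" "braids_name N X"
  shows "braids_name N Y"
  using assms by (induction rule: rtranclp_induct) (auto dest: dec_stab_braids_name)

text \<open>Each step lowers the number of strands, so every sequence of steps terminates.\<close>

lemma stabilizes_fully_exists:
  assumes "braids_name N X"
  shows "\<exists>Y. stabilizes_fully X Y"
  using assms
proof (induction "fst X" arbitrary: X rule: less_induct)
  case less
  show ?case
  proof (cases "\<exists>Z. dec_stab X Z")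
    case True
    then obtain Z where Z: "dec_stab X Z" by blast
    with less obtain Y where "stabilizes_fully Z Y" using dec_stab_braids_name by blast
    with Z show ?thesis
      unfolding stabilizes_fully_def by (meson converse_rtranclp_into_rtranclp)
  next
    case False
    then have "stabilizes_fully X X" by (simp add: stabilizes_fully_def)
    then show ?thesis ..
  qed
qed

section \<open>Names and chord systems\<close>

text \<open>The representative chord system that occurs inside
  \<open>diagram_of_name\<close>.\<close>

definition fibres :: "nat list \<Rightarrow> nat set set" where
  "fibres N = (\<lambda>r. {p. p < length N \<and> N ! p = r}) ` set N"

lemma Union_fibres: "\<Union> (fibres N) = {0..<length N}"
  by (auto simp: fibres_def)

lemma card_fibres: "card (fibres N) = card (set N)"
  unfolding fibres_def
proof (rule card_image, rule inj_onI)
  fix r r' assume "r \<in> set N" "{p. p < length N \<and> N ! p = r} = {p. p < length N \<and> N ! p = r'}"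
  then show "r = r'" by (auto simp: in_set_conv_nth)
qed

lemma chord_systems_D:
  assumes "P \<in> chord_systems n"
  shows "\<Union> P = {0..<2 * n}" "\<And>c. c \<in> P \<Longrightarrow> card c = 2" "card P = n" "finite P"
    and "\<And>c c' p. c \<in> P \<Longrightarrow> c' \<in> P \<Longrightarrow> p \<in> c \<Longrightarrow> p \<in> c' \<Longrightarrow> c = c'"
proof -
  have po: "partition_on {0..<2 * n} P" and c2: "\<And>c. c \<in> P \<Longrightarrow> card c = 2"
    using assms by (auto simp: chord_systems_def)
  show U: "\<Union> P = {0..<2 * n}" using po by (simp add: partition_on_def)
  show "c \<in> P \<Longrightarrow> card c = 2" for c by (fact c2)
  show fin: "finite P" using finite_elements[OF _ po] by simp
  show dis: "c \<in> P \<Longrightarrow> c' \<in> P \<Longrightarrow> p \<in> c \<Longrightarrow> p \<in> c' \<Longrightarrow> c = c'" for c c' p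
    using po by (auto simp: partition_on_def disjoint_def)
  have "2 * card P = card (\<Union> P)"
  proof (rule card_partition)
    show "finite (\<Union> P)" by (simp add: U)
    show "c \<inter> c' = {}" if "c \<in> P" "c' \<in> P" "c \<noteq> c'" for c c'
      using dis that by blast
  qed (fact fin, fact c2)
  then show "card P = n" by (simp add: U)
qed

lemma chord_at_eq:
  assumes "P \<in> chord_systems n" "c \<in> P" "p \<in> c"
  shows "chord_at P p = c"
  unfolding chord_at_def
proof (rule the_equality)
  show "c' = c" if "c' \<in> P \<and> p \<in> c'" for c'
    using chord_systems_D(5)[OF assms(1) _ assms(2) _ assms(3)] that by simp
qed (use assms in simp)

lemma chord_at_mem:
  assumes "P \<in> chord_systems n" "p < 2 * n"
  shows "chord_at P p \<in> P" "p \<in> chord_at P p"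
proof -
  have "p \<in> \<Union> P" using chord_systems_D(1)[OF assms(1)] assms(2) by simp
  then obtain c where c: "c \<in> P" "p \<in> c" by blast
  then have "chord_at P p = c" by (rule chord_at_eq[OF assms(1)])
  with c show "chord_at P p \<in> P" "p \<in> chord_at P p" by simp_all
qed

section \<open>Rotations of chord systems\<close>

lemma rotate_chords_rotate_chords:
  "rotate_chords n k (rotate_chords n k' P) = rotate_chords n (k' + k) P"
  by (simp add: rotate_chords_def image_image mod_add_left_eq add.assoc)

lemma rotate_chords_0:
  assumes "P \<in> chord_systems n"
  shows "rotate_chords n (2 * n * k) P = P"
proof -
  have "(\<lambda>p. (p + 2 * n * k) mod (2 * n)) ` c = c" if "c \<in> P" for c
  proof -
    have "\<forall>p\<in>c. p < 2 * n" using chord_systems_D(1)[OF assms] that by auto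
    then have "(p + 2 * n * k) mod (2 * n) = p" if "p \<in> c" for p using that by simp
    then show ?thesis by simp
  qed
  then show ?thesis by (simp add: rotate_chords_def)
qed

lemma rotate_chords_chord_systems:
  assumes "P \<in> chord_systems n" "0 < n"
  shows "rotate_chords n k P \<in> chord_systems n"
proof -
  let ?f = "\<lambda>p. (p + k) mod (2 * n)"
  have "bij_betw ?f {..<2 * n} {..<2 * n}" using assms(2) by (intro bij_betw_rotation) simp
  then have bij: "bij_betw ?f {0..<2 * n} {0..<2 * n}" by (simp add: atLeast0LessThan)
  have sub: "c \<subseteq> {0..<2 * n}" if "c \<in> P" for c
    using chord_systems_D(1)[OF assms(1)] that by blast
  have "partition_on (?f ` {0..<2 * n}) ((`) ?f ` P - {{}})"
    using assms(1) bij by (intro partition_on_inj_image) (auto simp: chord_systems_def bij_betw_def)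
  moreover have "{} \<notin> (`) ?f ` P" using chord_systems_D(2)[OF assms(1)] by force
  moreover have "card (?f ` c) = 2" if "c \<in> P" for c
    using card_image[OF inj_on_subset[OF bij_betw_imp_inj_on[OF bij] sub[OF that]]]
      chord_systems_D(2)[OF assms(1) that] by simp
  ultimately show ?thesis
    using bij by (auto simp: chord_systems_def rotate_chords_def bij_betw_def)
qed

lemma equiv_same_diagram:
  assumes "0 < n"
  shows "equiv (chord_systems n) (same_diagram n)"
proof (rule equivI)
  show "same_diagram n \<subseteq> chord_systems n \<times> chord_systems n" by (auto simp: same_diagram_def)
  show "refl_on (chord_systems n) (same_diagram n)"
    by (rule refl_onI) (use rotate_chords_0[of _ n 0] in \<open>auto simp: same_diagram_def intro: exI[of _ 0]\<close>)
  show "trans (same_diagram n)"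
    by (rule transI) (auto simp: same_diagram_def rotate_chords_rotate_chords)
  show "sym (same_diagram n)"
  proof (rule symI)
    fix P Q assume "(P, Q) \<in> same_diagram n"
    then obtain k where k: "P \<in> chord_systems n" "Q \<in> chord_systems n" "Q = rotate_chords n k P"
      by (auto simp: same_diagram_def)
    \<comment> \<open>The inverse rotation: together with \<open>k\<close> it amounts to
      \<open>k\<close> full turns.\<close>
    have "rotate_chords n (2 * n * k - k) Q = rotate_chords n (2 * n * k) P"
      using assms by (simp add: k(3) rotate_chords_rotate_chords)
    then have "P = rotate_chords n (2 * n * k - k) Q" using rotate_chords_0[OF k(1)] by simp
    with k(1,2) show "(Q, P) \<in> same_diagram n" unfolding same_diagram_def by blast
  qed
qed

text \<open>Each strand of the canonical braiding meets exactly one letter, so the strands are the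
  single entries of \<open>N\<close> and the invariant holds at the start.\<close>

lemma canonical_braiding_braids_name:
  assumes "length N = 2 * n" "set N = {1..n}" "fibres N \<in> chord_systems n"
  shows "braids_name N (2 * n, canonical_braiding N)"
proof -
  let ?C = "canonical_braiding N"
  have len: "length ?C = n" using assms(1) by (simp add: canonical_braiding_def)
  have nth: "?C ! (r - 1) = Suc ` {p. p < length N \<and> N ! p = r}" if "r \<in> {1..n}" for r
  proof -
    have "?C ! (r - 1) = {p + 1 |p. p < length N \<and> N ! p = r}"
      using that assms(1) unfolding canonical_braiding_def
      by (subst nth_map) (auto simp: nth_upt simp del: upt_Suc)
    then show ?thesis by auto
  qed
  have "word_on (2 * n) ?C"
    unfolding word_on_def
  proof
    fix a assume "a \<in> set ?C"
    then obtain q where "q < n" "a = ?C ! q" using len by (auto simp: in_set_conv_nth)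
    then have a: "a = Suc ` {p. p < length N \<and> N ! p = Suc q}" using nth[of "Suc q"] by simp
    \<comment> \<open>The positions of a label form a chord, hence there are two of them and the
      letter joins distinct strands.\<close>
    have "{p. p < length N \<and> N ! p = Suc q} \<in> fibres N"
      using \<open>q < n\<close> assms(2) by (auto simp: fibres_def)
    then have "card {p. p < length N \<and> N ! p = Suc q} = 2"
      using chord_systems_D(2)[OF assms(3)] by blast
    then obtain x y where xy: "{p. p < length N \<and> N ! p = Suc q} = {x, y}" "x \<noteq> y"
      by (auto simp: card_2_iff)
    have "x < length N" "y < length N" using xy(1) by auto
    moreover have "a = {Suc x, Suc y}" by (simp add: a xy(1))
    ultimately show "\<exists>i j. i \<noteq> j \<and> i \<in> {1..2 * n} \<and> j \<in> {1..2 * n} \<and> a = {i, j}"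
      using xy(2) assms(1) by (intro exI[of _ "Suc x"] exI[of _ "Suc y"]) simp
  qed
  moreover have "strand_labels ?C (Suc k) = [N ! k]" if "k < 2 * n" for k
  proof (rule strictly_increasing_unique[OF strictly_increasing_strand_labels])
    have "N ! k \<in> {1..n}" using that assms(1,2) nth_mem[of k N] by simp
    then show "set (strand_labels ?C (Suc k)) = set [N ! k]"
      using that assms(1) by (auto simp: set_strand_labels len nth simp del: One_nat_def)
  qed simp
  then have "strands (2 * n, ?C) = map (\<lambda>x. [x]) N"
    using assms(1) by (auto intro!: nth_equalityI simp: strands_nth)
  ultimately show ?thesis by (auto simp: braids_name_def concat_map_singleton)
qed

section \<open>The algorithm\<close>

text \<open>Entry \<open>t\<close> of the name belongs to the marked point \<open>s + t\<close>, so
  points become positions by the rotation through \<open>-s\<close>, written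
  \<open>2 * n - s\<close>.\<close>

lemma name_from_props:
  assumes "0 < n" "P \<in> chord_systems n" "l \<in> labelings n P" "s < 2 * n"
  defines "N \<equiv> name_from n P l s"
  shows "length N = 2 * n" "set N = {1..n}" "fibres N = rotate_chords n (2 * n - s) P"
proof -
  show len: "length N = 2 * n" by (simp add: N_def name_from_def)
  have nth: "N ! t = l (chord_at P ((t + s) mod (2 * n)))" if "t < 2 * n" for t
    using that by (simp add: N_def name_from_def add.commute)
  have bij: "bij_betw l P {1..n}" using assms(3) by (simp add: labelings_def)
  have fib: "{t. t < length N \<and> N ! t = l c} = (\<lambda>p. (p + (2 * n - s)) mod (2 * n)) ` c"
    if "c \<in> P" for c
  proof -
    have mem: "t < length N \<and> N ! t = l c \<longleftrightarrow> t < 2 * n \<and> (t + s) mod (2 * n) \<in> c" for t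
    proof (cases "t < 2 * n")
      case True
      have "(t + s) mod (2 * n) < 2 * n" using assms(1) by simp
      note ch = chord_at_mem[OF assms(2) this]
      have "N ! t = l c \<longleftrightarrow> chord_at P ((t + s) mod (2 * n)) = c"
        using True nth ch that bij by (auto simp: bij_betw_def inj_on_def)
      also have "\<dots> \<longleftrightarrow> (t + s) mod (2 * n) \<in> c"
        using ch chord_at_eq[OF assms(2) that] by auto
      finally show ?thesis using True len by simp
    qed (use len in simp)
    have csub: "p < 2 * n" if "p \<in> c" for p
      using chord_systems_D(1)[OF assms(2)] that \<open>c \<in> P\<close> by auto
    have inv1: "((p + (2 * n - s)) mod (2 * n) + s) mod (2 * n) = p" if "p < 2 * n" for p
      using that assms(4) by (simp add: mod_add_left_eq)
    have inv2: "((t + s) mod (2 * n) + (2 * n - s)) mod (2 * n) = t" if "t < 2 * n" for t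
    proof -
      have "((t + s) mod (2 * n) + (2 * n - s)) mod (2 * n) = (t + s + (2 * n - s)) mod (2 * n)"
        by (rule mod_add_left_eq)
      then show ?thesis using that assms(4) by simp
    qed
    show ?thesis
      unfolding mem
    proof (intro set_eqI iffI)
      fix t assume t: "t \<in> {t. t < 2 * n \<and> (t + s) mod (2 * n) \<in> c}"
      show "t \<in> (\<lambda>p. (p + (2 * n - s)) mod (2 * n)) ` c"
        by (rule image_eqI[where x = "(t + s) mod (2 * n)"]) (use t inv2[of t] in simp_all)
    next
      fix t assume "t \<in> (\<lambda>p. (p + (2 * n - s)) mod (2 * n)) ` c"
      then obtain p where "p \<in> c" "t = (p + (2 * n - s)) mod (2 * n)" by blast
      then show "t \<in> {t. t < 2 * n \<and> (t + s) mod (2 * n) \<in> c}"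
        using inv1[of p] csub[of p] assms(1) by simp
    qed
  qed
  have "l ` P \<subseteq> set N"
  proof
    fix x assume "x \<in> l ` P"
    then obtain c where c: "c \<in> P" "x = l c" by blast
    then have "c \<noteq> {}" using chord_systems_D(2)[OF assms(2)] by force
    then have "{t. t < length N \<and> N ! t = l c} \<noteq> {}" using fib[OF c(1)] by simp
    then obtain t where "t < length N" "N ! t = l c" by blast
    then show "x \<in> set N" using c(2) nth_mem[of t N] by simp
  qed
  moreover have "set N \<subseteq> l ` P"
    using chord_at_mem(1)[OF assms(2)] assms(1) by (auto simp: N_def name_from_def)
  ultimately have setN: "set N = l ` P" by blast
  with bij show "set N = {1..n}" by (simp add: bij_betw_def)
  show "fibres N = rotate_chords n (2 * n - s) P"
    unfolding fibres_def rotate_chords_def setN image_image using fib by (intro image_cong) auto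
qed

text \<open>Labels of points that agree exactly along chords descend to an injective labelling of
  chords; with \<open>n\<close> chords it is onto.\<close>

lemma labeling_of_point_labels:
  assumes P: "P \<in> chord_systems n"
    and f: "\<And>p. p < 2 * n \<Longrightarrow> f p \<in> {1..n}"
    and same: "\<And>p q. p < 2 * n \<Longrightarrow> q < 2 * n \<Longrightarrow> f p = f q \<longleftrightarrow> chord_at P p = chord_at P q"
  shows "\<exists>l\<in>labelings n P. \<forall>p<2 * n. l (chord_at P p) = f p"
proof -
  \<comment> \<open>\<open>Min c\<close> merely selects an endpoint of \<open>c\<close>;
    \<open>restrict\<close> is there because members of \<open>labelings\<close> are
    extensional.\<close>
  define l where "l = restrict (\<lambda>c. f (Min c)) P"
  have Min: "Min c < 2 * n" "chord_at P (Min c) = c" if "c \<in> P" for c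
  proof -
    have "finite c" "c \<noteq> {}" using chord_systems_D(2)[OF P that] by (auto intro: card_ge_0_finite)
    then have "Min c \<in> c" by simp
    then show "Min c < 2 * n" "chord_at P (Min c) = c"
      using that chord_systems_D(1)[OF P] chord_at_eq[OF P that] by auto
  qed
  have val: "l (chord_at P p) = f p" if "p < 2 * n" for p
    using that chord_at_mem[OF P that] Min same by (simp add: l_def)
  have inj: "inj_on l P"
  proof (rule inj_onI)
    fix d d' assume d: "d \<in> P" "d' \<in> P" "l d = l d'"
    then have "f (Min d) = f (Min d')" by (simp add: l_def)
    then show "d = d'" using same[OF Min(1) Min(1), OF d(1,2)] Min(2)[OF d(1)] Min(2)[OF d(2)] by simp
  qed
  moreover have "l ` P = {1..n}"
  proof (rule card_subset_eq)
    show "l ` P \<subseteq> {1..n}" using Min f by (auto simp: l_def)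
    show "card (l ` P) = card {1..n}" using card_image[OF inj] chord_systems_D(3)[OF P] by simp
  qed simp
  ultimately have "l \<in> labelings n P" by (simp add: labelings_def bij_betw_def l_def)
  with val show ?thesis by (intro bexI[of _ l]) simp_all
qed

text \<open>
  The labels of a braiding can be shifted cyclically so that the chosen chord is labelled 1; this
  plays the role of conjugating the word.
\<close>

lemma labeling_of_braiding:
  assumes n: "0 < n" and P: "P \<in> chord_systems n" and c: "c \<in> P" "s \<in> c"
    and W: "is_braiding m W (same_diagram n `` {P})"
  obtains l where "l \<in> labelings n P" "l c = 1"
    "cyclic_descents (2 * n) ((!) (name_from n P l s)) \<le> m"
proof -
  define M where "M = concat (strands (m, W))"
  have word: "word_on m W" and dia: "same_diagram (length M div 2) `` {fibres M} = same_diagram n `` {P}"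
    using W by (auto simp: is_braiding_def braid_closure_strands diagram_of_name_def fibres_def M_def)
  have "(P, P) \<in> same_diagram n"
    using equiv_same_diagram[OF n] P by (meson equivE refl_onD)
  \<comment> \<open>A priori the closure has \<open>length M div 2\<close> chords. As
    \<open>P\<close> lies in its class, \<open>P\<close> is a chord system for both sizes, which
    forces them to agree.\<close>
  then have "(fibres M, P) \<in> same_diagram (length M div 2)" using dia by blast
  then have QP: "fibres M \<in> chord_systems (length M div 2)" "P \<in> chord_systems (length M div 2)"
    by (auto simp: same_diagram_def)
  have "{0..<2 * n} = {0..<2 * (length M div 2)}"
    using chord_systems_D(1)[OF P] chord_systems_D(1)[OF QP(2)] by simp
  from arg_cong[OF this, of card] have n': "length M div 2 = n" by simp
  \<comment> \<open>The division leaves the parity open; it is settled because the fibres cover all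
    positions of \<open>M\<close>.\<close>
  have len: "length M = 2 * n"
  proof -
    have "{0..<2 * n} = {0..<length M}" using chord_systems_D(1)[OF QP(1)] Union_fibres[of M] n' by simp
    then show ?thesis by (metis card_atLeastLessThan diff_zero)
  qed
  have Q: "fibres M \<in> chord_systems n" using QP n' by simp
  \<comment> \<open>Every letter ends on some strand, so every label occurs in \<open>M\<close>;
    counting chords then gives \<open>length W = n\<close>.\<close>
  have "set M = {1..length W}"
  proof -
    have "\<exists>k\<in>{1..m}. k \<in> W ! (r - 1)" if "r \<in> {1..length W}" for r
      using word_on_letter[OF word that] by (metis insertI1)
    then show ?thesis by (fastforce simp: M_def strands_def set_strand_labels)
  qed
  moreover have "card (set M) = n" using card_fibres chord_systems_D(3)[OF Q] by simp
  ultimately have setM: "set M = {1..n}" by simp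
  have "M \<noteq> []" using len n by auto
  then have "strands (m, W) \<noteq> []" by (auto simp: M_def)
  then have "Suc (descents M) \<le> m"
    using descents_concat_le[of "strands (m, W)"] strictly_increasing_strands[of _ "(m, W)"]
    by (simp add: M_def)
  then have cycM: "cyclic_descents (2 * n) ((!) M) \<le> m"
    using cyclic_descents_nth[OF \<open>M \<noteq> []\<close>] len by simp
  have "fibres M \<in> same_diagram n `` {P}"
    using equiv_same_diagram[OF n] Q dia n' by (metis equiv_class_self)
  then obtain k where k: "fibres M = rotate_chords n k P" by (auto simp: same_diagram_def)
  let ?L = "2 * n"
  \<comment> \<open>The label that the braiding gives to the marked point \<open>p\<close> of
    \<open>P\<close>, carried over by the rotation from \<open>P\<close> to
    \<open>fibres M\<close>.\<close>
  define g where "g p = M ! ((p + k) mod ?L)" for p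
  have g: "g p \<in> {1..n}" for p using setM len n nth_mem[of "(p + k) mod ?L" M] by (simp add: g_def)
  have same: "g p = g q \<longleftrightarrow> chord_at P p = chord_at P q" if "p < ?L" "q < ?L" for p q
  proof -
    have "{t. t < length M \<and> M ! t = g p} \<in> fibres M"
      using g[of p] setM by (auto simp: fibres_def)
    then obtain d where d: "d \<in> P" "{t. t < length M \<and> M ! t = g p} = (\<lambda>p. (p + k) mod ?L) ` d"
      unfolding k rotate_chords_def by blast
    have inj: "inj_on (\<lambda>p. (p + k) mod ?L) {..<?L}"
      using bij_betw_rotation[of ?L k] n by (simp add: bij_betw_def)
    have dsub: "d \<subseteq> {..<?L}" using d(1) chord_systems_D(1)[OF P] by auto
    have iff: "g q' = g p \<longleftrightarrow> q' \<in> d" if "q' < ?L" for q'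
    proof -
      have "g q' = g p \<longleftrightarrow> (q' + k) mod ?L \<in> {t. t < length M \<and> M ! t = g p}"
        using n len by (simp add: g_def)
      also have "\<dots> \<longleftrightarrow> q' \<in> d"
        unfolding d(2) using inj_on_image_mem_iff[OF inj _ dsub] that by blast
      finally show ?thesis .
    qed
    have "chord_at P p = d" using iff[of p] that chord_at_eq[OF P d(1)] by simp
    then have "chord_at P p = chord_at P q \<longleftrightarrow> q \<in> d"
      using chord_at_eq[OF P d(1)] chord_at_mem[OF P that(2)] by metis
    then show ?thesis using iff[OF that(2)] by auto
  qed
  \<comment> \<open>Shifting by the label of the chosen endpoint makes that label 1.\<close>
  let ?f = "\<lambda>p. shift_label n (g s) (g p)"
  have f: "?f p = ?f q \<longleftrightarrow> g p = g q" for p q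
    using inj_on_eq_iff[OF inj_on_shift_label g g] .
  have "\<exists>l\<in>labelings n P. \<forall>p<?L. l (chord_at P p) = ?f p"
  proof (rule labeling_of_point_labels[OF P])
    show "?f p \<in> {1..n}" if "p < ?L" for p using shift_label_range[OF n] .
    show "?f p = ?f q \<longleftrightarrow> chord_at P p = chord_at P q" if "p < ?L" "q < ?L" for p q
      using f same[OF that] by simp
  qed
  then obtain l where l: "l \<in> labelings n P" "\<forall>p<?L. l (chord_at P p) = ?f p" ..
  have s: "s < ?L" using c chord_systems_D(1)[OF P] by auto
  have "l c = 1" using l(2)[rule_format, OF s] chord_at_eq[OF P c] by simp
  moreover have "cyclic_descents ?L ((!) (name_from n P l s)) \<le> m"
  proof -
    \<comment> \<open>The new name differs from \<open>M\<close> by rotations and one cyclic shift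
      of labels, none of which changes the count.\<close>
    have "cyclic_descents ?L ((!) (name_from n P l s)) = cyclic_descents ?L (\<lambda>p. ?f ((p + s) mod ?L))"
      unfolding cyclic_descents_def using n
      by (intro sum.cong) (auto simp: name_from_def l add.commute)
    also have "\<dots> = cyclic_descents ?L (\<lambda>p. g p)"
      using n g cyclic_descents_rotation[of ?L ?f s] cyclic_descents_shift_label[of ?L n g "g s"] by simp
    also have "\<dots> = cyclic_descents ?L ((!) M)"
      using n cyclic_descents_rotation[of ?L "(!) M" k] by (simp add: g_def)
    finally show ?thesis using cycM by simp
  qed
  ultimately show thesis by (rule that[OF l(1)])
qed

theorem theorem3p2:
  fixes n :: nat and D :: "nat set set set" and P :: "nat set set" and c :: "nat set" and s :: nat
  assumes "n \<ge> 1"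
    and "D \<in> chord_diagrams n"
    and "P \<in> D"
    and "c \<in> P"
    and "s \<in> c"
  shows "(\<exists>R. recorded_by_run n P c s R) \<and>
         (\<forall>R. recorded_by_run n P c s R \<longrightarrow> Min R = braid_index D)"
proof -
  have n: "0 < n" using assms(1) by simp
  note eq = equiv_same_diagram[OF n]
  have P: "P \<in> chord_systems n"
    using assms(2,3) in_quotient_imp_subset[OF eq] by (auto simp: chord_diagrams_def)
  have D: "D = same_diagram n `` {P}"
    using assms(2,3) eq P by (metis Image_singleton_iff chord_diagrams_def equiv_class_eq_iff quotientE)
  have s: "s < 2 * n" using assms(4,5) chord_systems_D(1)[OF P] by auto
  define Ls where "Ls = {l \<in> labelings n P. l c = 1}"
  let ?N = "\<lambda>l. name_from n P l s"
  let ?X = "\<lambda>l. (2 * n, canonical_braiding (?N l))"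
  have name: "length (?N l) = 2 * n" "set (?N l) = {1..n}"
      "fibres (?N l) = rotate_chords n (2 * n - s) P" if "l \<in> Ls" for l
    using that name_from_props[OF n P _ s, of l] by (auto simp: Ls_def)
  have start: "braids_name (?N l) (?X l)" if "l \<in> Ls" for l
    using name[OF that] rotate_chords_chord_systems[OF P n]
    by (intro canonical_braiding_braids_name) auto
  have diagram: "diagram_of_name (?N l) = D" if "l \<in> Ls" for l
  proof -
    have "(P, fibres (?N l)) \<in> same_diagram n"
      using name(3)[OF that] rotate_chords_chord_systems[OF P n] P by (auto simp: same_diagram_def)
    then have "same_diagram n `` {P} = same_diagram n `` {fibres (?N l)}"
      using equiv_class_eq[OF eq] by blast
    then show ?thesis
      using name(1)[OF that] by (simp add: D diagram_of_name_def fibres_def)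
  qed
  \<comment> \<open>The outcome is a braiding of \<open>D\<close>, and its number of strands depends
    only on the labelling, not on the order of stabilizations.\<close>
  have end_braiding: "is_braiding (fst Y) (snd Y) D"
      and end_count: "fst Y = cyclic_descents (2 * n) ((!) (?N l))"
    if l: "l \<in> Ls" and "stabilizes_fully (?X l) Y" for l Y
  proof -
    have Y: "braids_name (?N l) Y" "\<nexists>Z. dec_stab Y Z"
      using that dec_stab_rtranclp_braids_name[OF _ start[OF l]]
      unfolding stabilizes_fully_def by blast+
    then show "is_braiding (fst Y) (snd Y) D"
      using diagram[OF l] by (simp add: is_braiding_def braid_closure_strands braids_name_def)
    have ne: "?N l \<noteq> []" using name(1)[OF l] n by auto
    \<comment> \<open>As 1 is the least label, the passage from the last entry back to the first is
      always a descent; it makes up the \<open>Suc\<close> in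
      \<open>fully_stabilized_strands\<close>.\<close>
    have "hd (?N l) = 1"
      using ne l s chord_at_eq[OF P assms(4,5)] n by (simp add: hd_conv_nth name_from_def Ls_def)
    moreover have "last (?N l) \<in> {1..n}" using name(2)[OF l] last_in_set[OF ne] by simp
    ultimately have "cyclic_descents (2 * n) ((!) (?N l)) = Suc (descents (?N l))"
      using cyclic_descents_nth[OF ne] name(1)[OF l] by simp
    then show "fst Y = cyclic_descents (2 * n) ((!) (?N l))"
      using fully_stabilized_strands[OF Y(1) ne Y(2)] by simp
  qed
  have run: "recorded_by_run n P c s R \<longleftrightarrow>
      (\<exists>F. (\<forall>l\<in>Ls. stabilizes_fully (?X l) (F l)) \<and> R = (\<lambda>l. fst (F l)) ` Ls)" for R
    by (simp add: recorded_by_run_def Ls_def)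
  obtain F where F: "\<forall>l\<in>Ls. stabilizes_fully (?X l) (F l)"
    using bchoice[of Ls "\<lambda>l Y. stabilizes_fully (?X l) Y"] stabilizes_fully_exists[OF start] by blast
  have "finite Ls"
  proof (rule finite_subset)
    show "Ls \<subseteq> P \<rightarrow>\<^sub>E {1..n}"
      by (auto simp: Ls_def labelings_def PiE_def bij_betw_def)
    show "finite (P \<rightarrow>\<^sub>E {1..n})" using chord_systems_D(4)[OF P] by (intro finite_PiE) auto
  qed
  \<comment> \<open>Any labelling, shifted so that \<open>c\<close> receives 1. Its stabilized word
    shows that \<open>D\<close> has a braiding, so that the \<open>LEAST\<close> in
    \<open>braid_index\<close> is attained.\<close>
  obtain l1 where "l1 \<in> Ls"
  proof -
    have "card P = card {1..n}" using chord_systems_D(3)[OF P] by simp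
    then obtain h where h: "bij_betw h P {1..n}"
      using finite_same_card_bij[OF chord_systems_D(4)[OF P], of "{1..n}"] by auto
    let ?l = "restrict (\<lambda>d. shift_label n (h c) (h d)) P"
    have inj: "inj_on ?l P"
      using h comp_inj_on[of h P "shift_label n (h c)"] inj_on_shift_label[of n "h c"]
      by (simp add: bij_betw_def comp_def)
    moreover have "?l ` P = {1..n}"
    proof (rule card_subset_eq)
      show "?l ` P \<subseteq> {1..n}" using shift_label_range[OF n] by auto
      show "card (?l ` P) = card {1..n}" using card_image[OF inj] chord_systems_D(3)[OF P] by simp
    qed simp
    ultimately have "?l \<in> Ls" using assms(4) by (simp add: Ls_def labelings_def bij_betw_def)
    then show thesis by (rule that)
  qed
  have ex: "\<exists>W. is_braiding (braid_index D) W D"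
    unfolding braid_index_def by (rule LeastI_ex) (use end_braiding F \<open>l1 \<in> Ls\<close> in blast)
  then obtain W where "is_braiding (braid_index D) W (same_diagram n `` {P})" unfolding D[symmetric] ..
  then obtain l0 where "l0 \<in> labelings n P" "l0 c = 1"
      "cyclic_descents (2 * n) ((!) (?N l0)) \<le> braid_index D"
    by (rule labeling_of_braiding[OF n P assms(4,5)])
  then have l0: "l0 \<in> Ls" "cyclic_descents (2 * n) ((!) (?N l0)) \<le> braid_index D"
    by (simp_all add: Ls_def)
  have least: "braid_index D \<le> fst Y" if "l \<in> Ls" "stabilizes_fully (?X l) Y" for l Y
    unfolding braid_index_def using end_braiding[OF that] by (intro Least_le) blast
  have "Min R = braid_index D" if "recorded_by_run n P c s R" for R
  proof -
    from that have "\<exists>F. (\<forall>l\<in>Ls. stabilizes_fully (?X l) (F l)) \<and> R = (\<lambda>l. fst (F l)) ` Ls"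
      by (simp only: run)
    then obtain G where G: "\<forall>l\<in>Ls. stabilizes_fully (?X l) (G l)" "R = (\<lambda>l. fst (G l)) ` Ls"
      by (elim exE conjE)
    show ?thesis
    proof (rule Min_eqI)
      show "finite R" using \<open>finite Ls\<close> G(2) by simp
      show "braid_index D \<le> y" if "y \<in> R" for y
      proof -
        from that G(2) obtain l where l: "l \<in> Ls" "y = fst (G l)" by auto
        then show ?thesis using least[OF l(1) G(1)[rule_format, OF l(1)]] by simp
      qed
      \<comment> \<open>At most the braid index by the choice of \<open>l0\<close>, and at least
        that because the recorded word is a braiding of \<open>D\<close>.\<close>
      have "fst (G l0) = braid_index D"
        using l0(2) end_count[OF l0(1) G(1)[rule_format, OF l0(1)]]
          least[OF l0(1) G(1)[rule_format, OF l0(1)]] by simp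
      then show "braid_index D \<in> R" unfolding G(2) using l0(1) by (metis imageI)
    qed
  qed
  moreover have "\<exists>R. recorded_by_run n P c s R"
    unfolding run using F by (intro exI conjI) (assumption, rule refl)
  ultimately show ?thesis by blast
qed

end
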